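(* Let $n\ge 1$ and let $X_1,\dots,X_n$ be independent random variables uniformly distributed on $[0,1]$, with $M_n=\min(X_1,\dots,X_n)$. Let $v_n=\sup_{\tau\in\mathcal M_n}\mathbb P[X_\tau=M_n]$ be the supremum over the class $\mathcal M_n$ of memoryless stopping rules. Then $v_n$ is attained by a memoryless stopping rule of the form $$\tau=\min\{k\in\{1,\dots,n\}: X_k\le d_k\}$$ for some nondecreasing sequence of thresholds $0<d_1\le\cdots\le d_{n-1}<d_n=1$.
   Context: A memoryless stopping rule is a random variable $\tau$ with values in $[n]:=\{1,\dots,n\}$ such that for each $k\in[n]$ the event $\{\tau=k\}$ belongs to the $\sigma$-algebra $\sigma\{\tau>k-1,\,X_k\}$ generated by the event $\{\tau>k-1\}$ and the random variable $X_k$. The class of all memoryless stopping rules is denoted $\mathcal M_n$. *)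

theory Defs
  imports "HOL-Probability.Probability"
begin

text \<open>
  The sample is \<open>X 1, \<dots>, X n\<close>; values of \<open>X\<close> and of threshold sequences outside
  \<open>{1..n}\<close> play no role.
\<close>

definition memoryless_rules :: "'a measure \<Rightarrow> nat \<Rightarrow> (nat \<Rightarrow> 'a \<Rightarrow> real) \<Rightarrow> ('a \<Rightarrow> nat) set" where
  "memoryless_rules M n X =
    {\<tau> \<in> measurable M (count_space {1..n}).
      \<forall>k\<in>{1..n}. {\<omega> \<in> space M. \<tau> \<omega> = k} \<in>
        sigma_sets (space M)
          (insert {\<omega> \<in> space M. \<tau> \<omega> > k - 1} {X k -` A \<inter> space M | A. A \<in> sets borel})}"

definition sample_min :: "nat \<Rightarrow> (nat \<Rightarrow> 'a \<Rightarrow> real) \<Rightarrow> 'a \<Rightarrow> real" where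
  "sample_min n X \<omega> = Min ((\<lambda>i. X i \<omega>) ` {1..n})"

definition win_prob :: "'a measure \<Rightarrow> nat \<Rightarrow> (nat \<Rightarrow> 'a \<Rightarrow> real) \<Rightarrow> ('a \<Rightarrow> nat) \<Rightarrow> real" where
  "win_prob M n X \<tau> = measure M {\<omega> \<in> space M. X (\<tau> \<omega>) \<omega> = sample_min n X \<omega>}"

definition memoryless_value :: "'a measure \<Rightarrow> nat \<Rightarrow> (nat \<Rightarrow> 'a \<Rightarrow> real) \<Rightarrow> real" where
  "memoryless_value M n X = (SUP \<tau>\<in>memoryless_rules M n X. win_prob M n X \<tau>)"

text \<open>
  Uniform distribution only forces \<open>X k \<in> [0,1]\<close> almost surely, so on a null set no
  observation may fall below its threshold and the minimum below is then over the empty set.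
  A rule has threshold form if it is this minimum at every outcome where the minimum exists,
  and the minimum exists almost surely. If all \<open>X k\<close> take values in \<open>[0,1]\<close> everywhere
  and \<open>d n = 1\<close>, this is equality at every outcome.
\<close>

definition threshold_form ::
  "'a measure \<Rightarrow> nat \<Rightarrow> (nat \<Rightarrow> 'a \<Rightarrow> real) \<Rightarrow> (nat \<Rightarrow> real) \<Rightarrow> ('a \<Rightarrow> nat) \<Rightarrow> bool" where
  "threshold_form M n X d \<tau> \<longleftrightarrow>
    (\<forall>\<omega>\<in>space M. {k \<in> {1..n}. X k \<omega> \<le> d k} \<noteq> {} \<longrightarrow> \<tau> \<omega> = Min {k \<in> {1..n}. X k \<omega> \<le> d k}) \<and>
    (AE \<omega> in M. {k \<in> {1..n}. X k \<omega> \<le> d k} \<noteq> {})"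

end

theory Submission imports Defs "HOL-Combinatorics.Permutations" begin

text \<open>
  A memoryless rule stops at the first \<open>k\<close> with \<open>X k \<in> B k\<close>, so conditioning on \<open>X k = x\<close> its
  winning probability is the sum over \<open>k\<close> of the integral over \<open>x \<in> B k\<close> of
  \<open>(1 - x) ^ (n - k)\<close> times the product over \<open>j < k\<close> of the measures of \<open>{x..} - B j\<close>.
  Replacing every \<open>B j\<close> by the initial interval \<open>{..d j}\<close> of the same measure increases each
  factor and then, the integrand being decreasing in \<open>x\<close>, each integral; so threshold rules
  suffice, and by dominated convergence and compactness the best thresholds exist.
  Swapping \<open>d k > d (k + 1) > 0\<close> increases the value strictly unless an earlier threshold
  is \<open>1\<close>. This forces the optimal thresholds to increase; it also excludes \<open>d k = 1\<close> for
  \<open>k < n\<close>, because the thresholds after such a \<open>k\<close> are irrelevant and may be set to \<open>1/2\<close>.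
  Finally \<open>d k = 0\<close> is not optimal because raising it to a small \<open>e\<close> gains order \<open>e\<close> and
  loses order \<open>e\<^sup>2\<close>.
\<close>

section \<open>The uniform distribution on the unit interval and a rearrangement inequality\<close>

definition unif :: "real measure" where
  "unif = uniform_measure lborel {0..1}"

lemma sets_unif[simp, measurable_cong]: "sets unif = sets borel"
  by (simp add: unif_def)

lemma space_unif[simp]: "space unif = UNIV"
  by (simp add: unif_def)

interpretation unif: prob_space unif
  unfolding unif_def by (rule prob_space_uniform_measure) auto

lemma AE_unif_Icc: "AE x in unif. 0 \<le> x \<and> x \<le> 1"
  unfolding unif_def by (rule AE_uniform_measureI) auto

lemma AE_unif_neq: "AE x in unif. x \<noteq> c"
  unfolding unif_def
proof (rule AE_uniform_measureI)
  show "AE x in lborel. x \<in> {0..1} \<longrightarrow> x \<noteq> c"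
    using AE_lborel_singleton[of c] by eventually_elim auto
qed auto

lemma measure_unif: "B \<in> sets borel \<Longrightarrow> measure unif B = measure lborel ({0..1} \<inter> B)"
  unfolding unif_def by (subst measure_uniform_measure) auto

lemma measure_unif_atMost: "0 \<le> d \<Longrightarrow> d \<le> 1 \<Longrightarrow> measure unif {..d} = d"
proof -
  assume d: "0 \<le> d" "d \<le> 1"
  have "{0..1} \<inter> {..d} = {0..d}" using d by auto
  then show ?thesis using d by (simp add: measure_unif)
qed

lemma measure_unif_atLeast: "0 \<le> d \<Longrightarrow> d \<le> 1 \<Longrightarrow> measure unif {d..} = 1 - d"
proof -
  assume d: "0 \<le> d" "d \<le> 1"
  have "{0..1} \<inter> {d..} = {d..1}" using d by auto
  then show ?thesis using d by (simp add: measure_unif)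
qed

lemma measure_unif_greater_atLeast:
  assumes "0 \<le> d" "d \<le> 1" "0 \<le> x" "x \<le> 1"
  shows "measure unif ({d<..} \<inter> {x..}) = 1 - max x d"
proof (cases "x \<le> d")
  case True
  then have "{0..1} \<inter> ({d<..} \<inter> {x..}) = {d<..1}" using assms by auto
  then show ?thesis using assms True by (simp add: measure_unif max_def)
next
  case False
  then have "{0..1} \<inter> ({d<..} \<inter> {x..}) = {x..1}" using assms by auto
  then show ?thesis using assms False by (simp add: measure_unif max_def)
qed

text \<open>The set lies both in \<open>{x..}\<close> and in \<open>- B\<close>, and the bound is
  the smaller of their two measures. By the preceding lemma it is attained when \<open>B\<close> is
  an initial interval.\<close>

lemma measure_unif_Compl_atLeast:
  assumes "B \<in> sets borel" "0 \<le> x" "x \<le> 1"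
  shows "measure unif (- B \<inter> {x..}) \<le> 1 - max x (measure unif B)"
proof -
  have "measure unif (- B \<inter> {x..}) \<le> measure unif {x..}"
    using assms by (intro unif.finite_measure_mono) auto
  moreover have "measure unif (- B \<inter> {x..}) \<le> measure unif (- B)"
    using assms by (intro unif.finite_measure_mono) auto
  moreover have "measure unif (- B) = 1 - measure unif B"
    using unif.prob_compl[of B] assms by (simp add: Compl_eq_Diff_UNIV)
  ultimately show ?thesis using assms by (simp add: measure_unif_atLeast)
qed

text \<open>With \<open>d\<close> the measure of \<open>B\<close>, the difference of the two
  indicators has integral zero, so \<open>f\<close> may be compared with the constant
  \<open>f d\<close>. Points in \<open>B\<close> only lie beyond \<open>d\<close>, where
  \<open>f\<close> is at most \<open>f d\<close>; points in \<open>{..d}\<close> only lie before it,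
  where \<open>f\<close> is at least \<open>f d\<close>. The bound on \<open>f\<close> serves
  integrability.\<close>

lemma rearrangement_unif:
  fixes f :: "real \<Rightarrow> real"
  assumes B: "B \<in> sets borel" and f: "f \<in> borel_measurable borel"
    and bd: "\<And>x. 0 \<le> x \<Longrightarrow> x \<le> 1 \<Longrightarrow> \<bar>f x\<bar> \<le> 1"
    and anti: "\<And>x y. 0 \<le> x \<Longrightarrow> x \<le> y \<Longrightarrow> y \<le> 1 \<Longrightarrow> f y \<le> f x"
  shows "(\<integral>x. indicator B x * f x \<partial>unif) \<le> (\<integral>x. indicator {..measure unif B} x * f x \<partial>unif)"
proof -
  define d where "d = measure unif B"
  have d: "0 \<le> d" "d \<le> 1" by (auto simp: d_def)
  note [measurable] = f B
  have bdi: "AE x in unif. norm (indicator A x * f x) \<le> 1" for A :: "real set"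
    using AE_unif_Icc by eventually_elim (use bd in \<open>auto simp: indicator_def\<close>)
  have i1: "integrable unif (\<lambda>x. indicator B x * f x)"
    by (rule unif.integrable_const_bound[OF bdi]) simp
  have i2: "integrable unif (\<lambda>x. indicator {..d} x * f x)"
    by (rule unif.integrable_const_bound[OF bdi]) simp
  have i3: "integrable unif (indicator A :: real \<Rightarrow> real)" if "A \<in> sets borel" for A
    using that by (intro unif.integrable_const_bound[where B = 1]) (auto simp: indicator_def)
  have "(\<integral>x. indicator B x * f x \<partial>unif) - (\<integral>x. indicator {..d} x * f x \<partial>unif)
      = (\<integral>x. indicator B x * f x - indicator {..d} x * f x \<partial>unif)"
    using i1 i2 by simp
  also have "\<dots> \<le> (\<integral>x. f d * (indicator B x - indicator {..d} x) \<partial>unif)"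
  proof (rule integral_mono_AE)
    show "AE x in unif. indicator B x * f x - indicator {..d} x * f x
        \<le> f d * (indicator B x - indicator {..d} x)"
      using AE_unif_Icc
    proof eventually_elim
      case (elim x)
      then show ?case using anti[of x d] anti[of d x] d by (auto simp: indicator_def)
    qed
  qed (use i1 i2 i3 in auto)
  also have "\<dots> = f d * (measure unif B - measure unif {..d})"
    using i3 by simp
  also have "\<dots> = 0" using d by (simp add: measure_unif_atMost d_def)
  finally show ?thesis by (simp add: d_def)
qed

section \<open>The probability that a given observation is the least one\<close>

text \<open>Independence makes the joint law a product measure. Once coordinate \<open>k\<close> is
  fixed at \<open>x\<close>, the event for the remaining coordinates is the box with sides
  \<open>D j \<inter> {x..}\<close>, and Fubini gives the integral. The sets \<open>D j\<close> will
  express that the rule did not stop at time \<open>j\<close>.\<close>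

lemma (in prob_space) prob_iid_least:
  fixes X :: "nat \<Rightarrow> 'a \<Rightarrow> real"
  assumes ind: "indep_vars (\<lambda>_. borel) X I" and fin: "finite I" and k: "k \<in> I"
    and dist: "\<And>i. i \<in> I \<Longrightarrow> distr M borel (X i) = unif"
    and B: "B \<in> sets borel" and D: "\<And>j. D j \<in> sets borel"
  shows "prob {\<omega> \<in> space M. X k \<omega> \<in> B \<and> (\<forall>j\<in>I - {k}. X j \<omega> \<in> D j \<and> X k \<omega> \<le> X j \<omega>)} =
    (\<integral>x. indicator B x * (\<Prod>j\<in>I - {k}. measure unif (D j \<inter> {x..})) \<partial>unif)"
proof -
  interpret P: product_sigma_finite "\<lambda>_::nat. unif"
    by standard
  have rv: "X i \<in> borel_measurable M" if "i \<in> I" for i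
    using ind that by (auto simp: indep_vars_def)
  define J where "J = I - {k}"
  have J: "I = insert k J" "finite J" "k \<notin> J" using fin k by (auto simp: J_def)
  note [measurable] = B D
  define S where "S = {w \<in> space (PiM I (\<lambda>_. borel :: real measure)). w k \<in> B \<and> (\<forall>j\<in>J. w j \<in> D j \<and> w k \<le> w j)}"
  have kI[measurable]: "(\<lambda>w. w i) \<in> borel_measurable (PiM I (\<lambda>_. borel :: real measure))" if "i \<in> I" for i
    using that by simp
  have C: "{w \<in> space (PiM I (\<lambda>_. borel :: real measure)). w j \<in> A}
      \<in> sets (PiM I (\<lambda>_. borel :: real measure))" if "j \<in> I" "A \<in> sets borel" for j A
    using measurable_sets[OF kI[OF that(1)] that(2)] by (simp add: vimage_def Int_def conj_commute)
  then have S: "S \<in> sets (PiM I (\<lambda>_. borel :: real measure))"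
    unfolding S_def using k J B D
    by (intro sets.sets_Collect_conj sets.sets_Collect_finite_All borel_measurable_le kI C) auto
  have setsP: "sets (PiM I (\<lambda>_. unif)) = sets (PiM I (\<lambda>_. borel :: real measure))"
    by (rule sets_PiM_cong) auto
  have rvp: "(\<lambda>\<omega>. \<lambda>i\<in>I. X i \<omega>) \<in> measurable M (PiM I (\<lambda>_. borel))"
    using rv by (intro measurable_restrict) auto
  have dd: "distr M (PiM I (\<lambda>_. borel)) (\<lambda>\<omega>. \<lambda>i\<in>I. X i \<omega>) = PiM I (\<lambda>_. unif)"
  proof -
    have "distr M (PiM I (\<lambda>_. borel)) (\<lambda>\<omega>. \<lambda>i\<in>I. X i \<omega>) = PiM I (\<lambda>i. distr M borel (X i))"
      using ind rv k by (subst indep_vars_iff_distr_eq_PiM'[symmetric]) auto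
    also have "\<dots> = PiM I (\<lambda>_. unif)" using dist by (intro PiM_cong) auto
    finally show ?thesis .
  qed
  have "emeasure M {\<omega> \<in> space M. X k \<omega> \<in> B \<and> (\<forall>j\<in>J. X j \<omega> \<in> D j \<and> X k \<omega> \<le> X j \<omega>)}
      = emeasure M ((\<lambda>\<omega>. \<lambda>i\<in>I. X i \<omega>) -` S \<inter> space M)"
    using J by (intro arg_cong[where f = "emeasure M"]) (auto simp: S_def space_PiM)
  also have "\<dots> = emeasure (PiM I (\<lambda>_. unif)) S"
    unfolding dd[symmetric] using S rvp by (subst emeasure_distr) auto
  also have "\<dots> = (\<integral>\<^sup>+w. indicator S w \<partial>PiM I (\<lambda>_. unif))"
    using S setsP by simp
  also have "\<dots> = (\<integral>\<^sup>+x. (\<integral>\<^sup>+w. indicator S (w(k := x)) \<partial>PiM J (\<lambda>_. unif)) \<partial>unif)"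
    unfolding J(1) using S setsP J by (subst P.product_nn_integral_insert_rev) auto
  also have "\<dots> = (\<integral>\<^sup>+x. ennreal (indicator B x * (\<Prod>j\<in>J. measure unif (D j \<inter> {x..}))) \<partial>unif)"
  proof (rule nn_integral_cong)
    fix x :: real
    have "(\<integral>\<^sup>+w. indicator S (w(k := x)) \<partial>PiM J (\<lambda>_. unif))
        = (\<integral>\<^sup>+w. indicator B x * indicator (Pi\<^sub>E J (\<lambda>j. D j \<inter> {x..})) w \<partial>PiM J (\<lambda>_. unif))"
      using J by (intro nn_integral_cong)
        (auto simp: indicator_def S_def space_PiM PiE_def Pi_def extensional_def split: if_splits)
    also have "\<dots> = indicator B x * emeasure (PiM J (\<lambda>_. unif)) (Pi\<^sub>E J (\<lambda>j. D j \<inter> {x..}))"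
      using J by (subst nn_integral_cmult_indicator) (auto intro!: sets_PiM_I_finite)
    also have "emeasure (PiM J (\<lambda>_. unif)) (Pi\<^sub>E J (\<lambda>j. D j \<inter> {x..})) = (\<Prod>j\<in>J. emeasure unif (D j \<inter> {x..}))"
      using J by (subst P.emeasure_PiM) auto
    also have "\<dots> = ennreal (\<Prod>j\<in>J. measure unif (D j \<inter> {x..}))"
      by (simp only: unif.emeasure_eq_measure prod_ennreal measure_nonneg)
    also have "indicator B x * ennreal (\<Prod>j\<in>J. measure unif (D j \<inter> {x..}))
        = ennreal (indicator B x * (\<Prod>j\<in>J. measure unif (D j \<inter> {x..})))"
      by (simp add: indicator_def)
    finally show "(\<integral>\<^sup>+w. indicator S (w(k := x)) \<partial>PiM J (\<lambda>_. unif))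
        = ennreal (indicator B x * (\<Prod>j\<in>J. measure unif (D j \<inter> {x..})))" .
  qed
  finally have e: "emeasure M {\<omega> \<in> space M. X k \<omega> \<in> B \<and> (\<forall>j\<in>J. X j \<omega> \<in> D j \<and> X k \<omega> \<le> X j \<omega>)}
     = (\<integral>\<^sup>+x. ennreal (indicator B x * (\<Prod>j\<in>J. measure unif (D j \<inter> {x..}))) \<partial>unif)" .
  \<comment> \<open>Measurability in \<open>x\<close> follows from monotonicity; the sign is changed
    to have an increasing function.\<close>
  have m: "(\<lambda>x. measure unif (D j \<inter> {x..})) \<in> borel_measurable borel" for j
  proof -
    have "antimono (\<lambda>x. measure unif (D j \<inter> {x..}))"
      by (intro antimonoI unif.finite_measure_mono) auto
    then have "mono (\<lambda>x. - measure unif (D j \<inter> {x..}))"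
      by (auto simp: mono_def antimono_def)
    from borel_measurable_mono[OF this] show ?thesis by simp
  qed
  have "(\<lambda>x. indicator B x * (\<Prod>j\<in>J. measure unif (D j \<inter> {x..}))) \<in> borel_measurable unif"
    using m unfolding measurable_cong_sets[OF sets_unif refl] by measurable
  then show ?thesis unfolding J_def[symmetric] measure_def[of M] e
    by (subst integral_eq_nn_integral) (auto intro!: prod_nonneg mult_nonneg_nonneg)
qed

section \<open>The value of a threshold sequence\<close>

text \<open>For \<open>x\<close> in the unit interval, summand \<open>k\<close> is the conditional
  probability, given \<open>X k = x\<close>, that the threshold rule stops at \<open>k\<close> and
  wins: every later observation is at least \<open>x\<close>, every earlier one is at least
  \<open>x\<close> and above its own threshold.\<close>

definition win_density :: "nat \<Rightarrow> (nat \<Rightarrow> real) \<Rightarrow> real \<Rightarrow> real" where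
  "win_density n d x =
    (\<Sum>k\<in>{1..n}. indicator {..d k} x * ((1 - x) ^ (n - k) * (\<Prod>j\<in>{1..<k}. 1 - max x (d j))))"

definition threshold_value :: "nat \<Rightarrow> (nat \<Rightarrow> real) \<Rightarrow> real" where
  "threshold_value n d = (\<integral>x. win_density n d x \<partial>unif)"

section \<open>Memoryless rules as first entrance times\<close>

text \<open>The sets with such a trace include the generators and are closed under complement and
  countable union. The generator \<open>E\<close> has the trace of the preimage of the whole space,
  so inside \<open>E\<close> membership in \<open>S\<close> is decided by \<open>f\<close>
  alone.\<close>

lemma trace_sigma_sets_insert_vimage:
  assumes "S \<in> sigma_sets \<Omega> (insert E {f -` A \<inter> \<Omega> | A. A \<in> sets N})" "E \<subseteq> \<Omega>"
    and N: "space N = UNIV"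
  shows "\<exists>A\<in>sets N. S \<inter> E = f -` A \<inter> E"
  using assms(1)
proof (induction rule: sigma_sets.induct)
  case (Basic a)
  then show ?case
  proof
    assume "a = E"
    then show ?thesis using N sets.top[of N] by (intro bexI[of _ UNIV]) auto
  next
    assume "a \<in> {f -` A \<inter> \<Omega> | A. A \<in> sets N}"
    then show ?thesis using assms(2) by blast
  qed
next
  case Empty
  show ?case by (intro bexI[of _ "{}"]) auto
next
  case (Compl a)
  then obtain A where A: "A \<in> sets N" "a \<inter> E = f -` A \<inter> E" by blast
  then show ?case using assms(2) N sets.compl_sets[OF A(1)] by (intro bexI[of _ "UNIV - A"]) auto
next
  case (Union a)
  then have "\<forall>i. \<exists>A. A \<in> sets N \<and> a i \<inter> E = f -` A \<inter> E" by blast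
  then obtain A where "\<forall>i. A i \<in> sets N \<and> a i \<inter> E = f -` A i \<inter> E" by metis
  then show ?case by (intro bexI[of _ "\<Union>i. A i"]) blast+
qed

text \<open>While the rule is still running, the choice to stop at \<open>k\<close> depends on
  \<open>X k\<close> only. Hence \<open>\<tau>\<close> is the first time at which an observation
  enters its fixed Borel set.\<close>

lemma memoryless_rule_regions:
  assumes "\<tau> \<in> memoryless_rules M n X"
  obtains B where "\<And>k. B k \<in> sets borel"
    and "\<And>k \<omega>. k \<in> {1..n} \<Longrightarrow> \<omega> \<in> space M \<Longrightarrow> \<tau> \<omega> > k - 1 \<Longrightarrow> \<tau> \<omega> = k \<longleftrightarrow> X k \<omega> \<in> B k"
proof -
  have "\<forall>k. \<exists>A. A \<in> sets borel \<and> (k \<in> {1..n} \<longrightarrow>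
      {\<omega> \<in> space M. \<tau> \<omega> = k} \<inter> {\<omega> \<in> space M. \<tau> \<omega> > k - 1} = X k -` A \<inter> {\<omega> \<in> space M. \<tau> \<omega> > k - 1})"
  proof
    fix k
    show "\<exists>A. A \<in> sets borel \<and> (k \<in> {1..n} \<longrightarrow>
      {\<omega> \<in> space M. \<tau> \<omega> = k} \<inter> {\<omega> \<in> space M. \<tau> \<omega> > k - 1} = X k -` A \<inter> {\<omega> \<in> space M. \<tau> \<omega> > k - 1})"
    proof (cases "k \<in> {1..n}")
      case True
      then have "\<exists>A\<in>sets borel. {\<omega> \<in> space M. \<tau> \<omega> = k} \<inter> {\<omega> \<in> space M. \<tau> \<omega> > k - 1}
          = X k -` A \<inter> {\<omega> \<in> space M. \<tau> \<omega> > k - 1}"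
        using assms unfolding memoryless_rules_def
        by (intro trace_sigma_sets_insert_vimage[where \<Omega> = "space M"]) auto
      then show ?thesis by blast
    next
      case False
      \<comment> \<open>A placeholder that keeps \<open>B k\<close> Borel for indices outside the
        sample.\<close>
      then show ?thesis by (intro exI[of _ "{}"] conjI impI) (simp, blast)
    qed
  qed
  from choice[OF this] obtain B where B: "\<And>k. B k \<in> sets borel"
    "\<And>k. k \<in> {1..n} \<Longrightarrow> {\<omega> \<in> space M. \<tau> \<omega> = k} \<inter> {\<omega> \<in> space M. \<tau> \<omega> > k - 1}
      = X k -` B k \<inter> {\<omega> \<in> space M. \<tau> \<omega> > k - 1}"
    by blast
  show ?thesis
  proof
    fix k \<omega> assume "k \<in> {1..n}" "\<omega> \<in> space M" "\<tau> \<omega> > k - 1"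
    then show "\<tau> \<omega> = k \<longleftrightarrow> X k \<omega> \<in> B k" using B(2)[of k] by blast
  qed (rule B(1))
qed

section \<open>Bounds, monotonicity and integrability of the winning density\<close>

lemma prod_Icc_remove:
  fixes g :: "nat \<Rightarrow> 'b::comm_monoid_mult"
  assumes "k \<in> {1..n}" 
  shows "(\<Prod>j\<in>{1..n} - {k}. if j < k then g j else c) = c ^ (n - k) * (\<Prod>j\<in>{1..<k}. g j)"
proof -
  have e: "{1..n} - {k} = {k<..n} \<union> {1..<k}" using assms by auto
  show ?thesis unfolding e by (subst prod.union_disjoint) auto
qed

text \<open>The exponent and the index set are arbitrary, so that the bounds also cover a product
  from which one factor has been taken out.\<close>

lemma win_density_term_bounds:
  assumes "\<And>j. 0 \<le> d j \<and> d j \<le> (1::real)" "0 \<le> x" "x \<le> 1"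
  shows "0 \<le> (1 - x) ^ m * (\<Prod>j\<in>J. 1 - max x (d j))" "(1 - x) ^ m * (\<Prod>j\<in>J. 1 - max x (d j)) \<le> 1"
proof -
  have 1: "0 \<le> (\<Prod>j\<in>J. 1 - max x (d j))" using assms by (intro prod_nonneg) auto
  have 2: "(\<Prod>j\<in>J. 1 - max x (d j)) \<le> 1" using assms by (intro prod_le_1) (auto simp: le_max_iff_disj)
  have 3: "(1 - x) ^ m \<le> 1" "0 \<le> (1-x)^m" using assms by (auto intro: power_le_one)
  show "0 \<le> (1 - x) ^ m * (\<Prod>j\<in>J. 1 - max x (d j))" using 1 3 by simp
  show "(1 - x) ^ m * (\<Prod>j\<in>J. 1 - max x (d j)) \<le> 1" using 1 2 3 by (simp add: mult_le_one)
qed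

text \<open>Every factor decreases in \<open>x\<close>. This is what the rearrangement requires; it
  also bounds an integrand on an initial interval from below by its value at a point further
  right.\<close>

lemma win_density_term_antimono:
  assumes "\<And>j. d j \<le> (1::real)" "x \<le> y" "y \<le> 1"
  shows "(1 - y) ^ m * (\<Prod>j\<in>J. 1 - max y (d j)) \<le> (1 - x) ^ m * (\<Prod>j\<in>J. 1 - max x (d j))"
  using assms by (intro mult_mono power_mono prod_mono prod_nonneg) (auto simp: max_def)

lemma win_density_measurable[measurable]: "win_density n d \<in> borel_measurable borel"
  unfolding win_density_def[abs_def] by measurable

lemma win_density_bounds:
  assumes "\<And>j. 0 \<le> d j \<and> d j \<le> (1::real)" "0 \<le> x" "x \<le> 1"
  shows "0 \<le> win_density n d x" "win_density n d x \<le> n"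
proof -
  have b: "0 \<le> indicator {..d k} x * ((1 - x) ^ (n - k) * (\<Prod>j\<in>{1..<k}. 1 - max x (d j)))
    \<and> indicator {..d k} x * ((1 - x) ^ (n - k) * (\<Prod>j\<in>{1..<k}. 1 - max x (d j))) \<le> 1" for k
    using win_density_term_bounds[of d x "n - k" "{1..<k}"] assms by (auto simp: indicator_def)
  show "0 \<le> win_density n d x"
    unfolding win_density_def using b by (intro sum_nonneg) blast
  have "win_density n d x \<le> (\<Sum>k\<in>{1..n}. 1)"
    unfolding win_density_def using b by (intro sum_mono) blast
  then show "win_density n d x \<le> n" by simp
qed

lemma AE_win_density_bound:
  assumes "\<And>j. 0 \<le> d j \<and> d j \<le> (1::real)"
  shows "AE x in unif. norm (win_density n d x) \<le> n"
  using AE_unif_Icc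
proof eventually_elim
  case (elim x)
  then show ?case using win_density_bounds[OF assms, of x n] by auto
qed

lemma integrable_win_density:
  assumes "\<And>j. 0 \<le> d j \<and> d j \<le> (1::real)"
  shows "integrable unif (win_density n d)"
proof -
  show ?thesis
    by (rule unif.integrable_const_bound[OF AE_win_density_bound[OF assms]]) simp_all
qed

lemma threshold_value_eq_sum:
  assumes d: "\<And>j. 0 \<le> d j \<and> d j \<le> 1"
  shows "threshold_value n d = (\<Sum>k\<in>{1..n}. \<integral>x. indicator {..d k} x *
    ((1 - x) ^ (n - k) * (\<Prod>j\<in>{1..<k}. 1 - max x (d j))) \<partial>unif)"
  unfolding threshold_value_def win_density_def
proof (rule Bochner_Integration.integral_sum)
  fix k
  show "integrable unif (\<lambda>x. indicator {..d k} x * ((1 - x) ^ (n - k) * (\<Prod>j\<in>{1..<k}. 1 - max x (d j))))"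
  proof (rule unif.integrable_const_bound[where B = 1])
    show "AE x in unif. norm (indicator {..d k} x * ((1 - x) ^ (n - k) * (\<Prod>j\<in>{1..<k}. 1 - max x (d j)))) \<le> 1"
      using AE_unif_Icc
    proof eventually_elim
      case (elim x)
      then show ?case
        using win_density_term_bounds[of d x "n - k" "{1..<k}"] d by (auto simp: indicator_def)
    qed
  qed measurable
qed

section \<open>Existence of optimal thresholds\<close>

text \<open>The cube of threshold sequences is compact by Tychonoff, and its product topology is
  first countable, so sequential continuity of the value suffices. Dominated convergence with the
  constant bound \<open>n\<close> provides it.\<close>

lemma threshold_value_attains_max:
  obtains d where "\<And>j. 0 \<le> d j \<and> d j \<le> 1"
    and "\<And>c. (\<And>j. 0 \<le> c j \<and> c j \<le> 1) \<Longrightarrow> threshold_value n c \<le> threshold_value n d"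
proof -
  define K where "K = (PiE UNIV (\<lambda>_. {0..1}) :: (nat \<Rightarrow> real) set)"
  have K: "d \<in> K \<longleftrightarrow> (\<forall>j. 0 \<le> d j \<and> d j \<le> 1)" for d
    by (auto simp: K_def PiE_def Pi_def)
  have "compactin (product_topology (\<lambda>_::nat. euclidean :: real topology) UNIV) K"
    unfolding K_def by (subst compactin_PiE) auto
  then have compact: "compact K" by (simp add: euclidean_product_topology)
  have "K \<noteq> {}" using K[of "\<lambda>_. 0"] by auto
  moreover have "continuous_on K (threshold_value n)"
  proof (rule continuous_on_sequentiallyI)
    fix u d assume u: "\<forall>i. u i \<in> K" and d: "d \<in> K" and lim: "u \<longlonglongrightarrow> d"
    have "continuous_on UNIV (\<lambda>d. d k :: real)" for k :: nat
      by simp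
    then have lim': "(\<lambda>i. u i k) \<longlonglongrightarrow> d k" for k
      by (rule continuous_on_tendsto_compose[OF _ lim]) auto
    \<comment> \<open>The indicator of \<open>{..d k}\<close> is discontinuous in the threshold only
      where \<open>x = d k\<close>, which excludes finitely many points.\<close>
    have AE: "AE x in unif. \<forall>k\<in>{1..n}. x \<noteq> d k"
      by (intro AE_finite_allI) (auto intro: AE_unif_neq)
    show "(\<lambda>i. threshold_value n (u i)) \<longlonglongrightarrow> threshold_value n d"
      unfolding threshold_value_def
    proof (rule integral_dominated_convergence)
      show "AE x in unif. (\<lambda>i. win_density n (u i) x) \<longlonglongrightarrow> win_density n d x"
        using AE
      proof eventually_elim
        case (elim x)
        have "(\<lambda>i. indicator {..u i k} x :: real) \<longlonglongrightarrow> indicator {..d k} x" if k: "k \<in> {1..n}" for k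
        proof (rule tendsto_eventually)
          consider "x < d k" | "d k < x" using elim k by fastforce
          then show "\<forall>\<^sub>F i in sequentially. indicator {..u i k} x = (indicator {..d k} x :: real)"
          proof cases
            case 1
            from order_tendstoD(1)[OF lim' 1] show ?thesis
              by eventually_elim (use 1 in \<open>auto simp: indicator_def\<close>)
          next
            case 2
            from order_tendstoD(2)[OF lim' 2] show ?thesis
              by eventually_elim (use 2 in \<open>auto simp: indicator_def\<close>)
          qed
        qed
        then show ?case unfolding win_density_def
          by (intro tendsto_intros lim')
      qed
      show "AE x in unif. norm (win_density n (u i) x) \<le> n" for i
        using u K by (intro AE_win_density_bound) auto
    next
      show "integrable unif (\<lambda>x. real n)" by simp
    qed auto
  qed
  ultimately obtain d where "d \<in> K" "\<forall>c\<in>K. threshold_value n c \<le> threshold_value n d"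
    using continuous_attains_sup[OF compact] by blast
  then show ?thesis using that[of d] K by auto
qed

section \<open>Winning probabilities compared with threshold values\<close>

context prob_space
begin

lemma prob_stop_at_sample_min:
  fixes X :: "nat \<Rightarrow> 'a \<Rightarrow> real"
  assumes ind: "indep_vars (\<lambda>_. borel) X {1..n}" and k: "k \<in> {1..n}"
    and dist: "\<And>i. i \<in> {1..n} \<Longrightarrow> distr M borel (X i) = unif"
    and B: "\<And>j. B j \<in> sets borel"
  shows "prob {\<omega> \<in> space M. X k \<omega> \<in> B k \<and> (\<forall>j\<in>{1..<k}. X j \<omega> \<notin> B j) \<and> (\<forall>j\<in>{1..n}. X k \<omega> \<le> X j \<omega>)} =
    (\<integral>x. indicator (B k) x * (measure unif {x..} ^ (n - k) * (\<Prod>j\<in>{1..<k}. measure unif (- B j \<inter> {x..}))) \<partial>unif)"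
proof -
  \<comment> \<open>Earlier observations must miss their stopping sets; later ones only have to be
    at least \<open>X k\<close>.\<close>
  define D where "D j = (if j < k then - B j else UNIV)" for j
  have D: "D j \<in> sets borel" for j
    using B[of j] by (auto simp: D_def borel_comp)
  have "{\<omega> \<in> space M. X k \<omega> \<in> B k \<and> (\<forall>j\<in>{1..<k}. X j \<omega> \<notin> B j) \<and> (\<forall>j\<in>{1..n}. X k \<omega> \<le> X j \<omega>)}
      = {\<omega> \<in> space M. X k \<omega> \<in> B k \<and> (\<forall>j\<in>{1..n} - {k}. X j \<omega> \<in> D j \<and> X k \<omega> \<le> X j \<omega>)}"
    using k by (auto simp: D_def)
  moreover have "(\<Prod>j\<in>{1..n} - {k}. measure unif (D j \<inter> {x..}))
      = measure unif {x..} ^ (n - k) * (\<Prod>j\<in>{1..<k}. measure unif (- B j \<inter> {x..}))" for x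
    unfolding prod_Icc_remove[OF k, symmetric] D_def by (intro prod.cong) auto
  ultimately show ?thesis
    using prob_iid_least[OF ind _ k dist B D] by simp
qed

lemma stop_at_sample_min_event:
  fixes X :: "nat \<Rightarrow> 'a \<Rightarrow> real"
  assumes ind: "indep_vars (\<lambda>_. borel) X {1..n}" and k: "k \<in> {1..n}"
    and B: "\<And>j. B j \<in> sets borel"
  shows "{\<omega> \<in> space M. X k \<omega> \<in> B k \<and> (\<forall>j\<in>{1..<k}. X j \<omega> \<notin> B j) \<and> (\<forall>j\<in>{1..n}. X k \<omega> \<le> X j \<omega>)} \<in> events"
proof -
  have rv: "X i \<in> borel_measurable M" if "i \<in> {1..n}" for i
    using ind that by (auto simp: indep_vars_def)
  have C: "{\<omega> \<in> space M. X j \<omega> \<in> A} \<in> events" if "j \<in> {1..n}" "A \<in> sets borel" for j A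
    using measurable_sets[OF rv[OF that(1)] that(2)] by (simp add: vimage_def Int_def conj_commute)
  have "{\<omega> \<in> space M. X j \<omega> \<notin> B j} \<in> events" if "j \<in> {1..n}" for j
    using C[of j "- B j"] that B[of j] by (auto simp: borel_comp)
  then show ?thesis
    using k B by (intro sets.sets_Collect_conj sets.sets_Collect_finite_All borel_measurable_le rv C) auto
qed

text \<open>A win means that, for some \<open>k\<close>, the rule stops at \<open>k\<close> on the
  sample minimum. Each such event is estimated in two moves: first the earlier stopping sets are
  replaced by initial intervals of the same measure, then the set at \<open>k\<close>
  itself.\<close>

lemma win_prob_le_threshold_value:
  fixes X :: "nat \<Rightarrow> 'a \<Rightarrow> real"
  assumes ind: "indep_vars (\<lambda>_. borel) X {1..n}"
    and dist: "\<And>i. i \<in> {1..n} \<Longrightarrow> distr M borel (X i) = unif"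
    and tau: "\<tau> \<in> memoryless_rules M n X"
  obtains d where "\<And>j. 0 \<le> d j \<and> d j \<le> 1" "win_prob M n X \<tau> \<le> threshold_value n d"
proof -
  from tau obtain B where B: "\<And>k. B k \<in> sets borel"
    and tB: "\<And>k \<omega>. k \<in> {1..n} \<Longrightarrow> \<omega> \<in> space M \<Longrightarrow> \<tau> \<omega> > k - 1 \<Longrightarrow> \<tau> \<omega> = k \<longleftrightarrow> X k \<omega> \<in> B k"
    using memoryless_rule_regions by blast
  define d where "d j = measure unif (B j)" for j
  have d: "0 \<le> d j \<and> d j \<le> 1" for j by (auto simp: d_def)
  define f where "f k x = (1 - x) ^ (n - k) * (\<Prod>j\<in>{1..<k}. 1 - max x (d j))" for k and x :: real
  define A where "A k = {\<omega> \<in> space M. X k \<omega> \<in> B k \<and> (\<forall>j\<in>{1..<k}. X j \<omega> \<notin> B j) \<and> (\<forall>j\<in>{1..n}. X k \<omega> \<le> X j \<omega>)}" for k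
  have A: "A k \<in> events" if "k \<in> {1..n}" for k
    unfolding A_def by (rule stop_at_sample_min_event[OF ind that B])
  have fm: "f k \<in> borel_measurable borel" for k
    unfolding f_def[abs_def] by measurable
  have "win_prob M n X \<tau> \<le> prob (\<Union>k\<in>{1..n}. A k)"
    unfolding win_prob_def
  proof (rule finite_measure_mono)
    show "(\<Union>k\<in>{1..n}. A k) \<in> events" using A by auto
    show "{\<omega> \<in> space M. X (\<tau> \<omega>) \<omega> = sample_min n X \<omega>} \<subseteq> (\<Union>k\<in>{1..n}. A k)"
    proof safe
      fix \<omega> assume \<omega>: "\<omega> \<in> space M" and win: "X (\<tau> \<omega>) \<omega> = sample_min n X \<omega>"
      have t: "\<tau> \<omega> \<in> {1..n}"
        using tau \<omega> by (auto simp: memoryless_rules_def dest: measurable_space)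
      have "X (\<tau> \<omega>) \<omega> \<in> B (\<tau> \<omega>)" using tB[OF t \<omega>] t by auto
      moreover have "X j \<omega> \<notin> B j" if "j \<in> {1..<\<tau> \<omega>}" for j
        using tB[of j \<omega>] t \<omega> that by force
      moreover have "X (\<tau> \<omega>) \<omega> \<le> X j \<omega>" if "j \<in> {1..n}" for j
        unfolding win sample_min_def using that by (intro Min_le) auto
      ultimately have "\<omega> \<in> A (\<tau> \<omega>)" using \<omega> by (auto simp: A_def)
      then show "\<omega> \<in> (\<Union>k\<in>{1..n}. A k)" using t by blast
    qed
  qed
  also have "\<dots> \<le> (\<Sum>k\<in>{1..n}. prob (A k))"
    using A by (intro finite_measure_subadditive_finite) auto
  also have "\<dots> \<le> (\<Sum>k\<in>{1..n}. \<integral>x. indicator {..d k} x * f k x \<partial>unif)"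
  proof (rule sum_mono)
    fix k assume k: "k \<in> {1..n}"
    have fb: "0 \<le> f k x \<and> f k x \<le> 1" if "0 \<le> x" "x \<le> 1" for x
      using win_density_term_bounds[of d x "n - k" "{1..<k}"] d that by (simp add: f_def)
    have "prob (A k) = (\<integral>x. indicator (B k) x *
        (measure unif {x..} ^ (n - k) * (\<Prod>j\<in>{1..<k}. measure unif (- B j \<inter> {x..}))) \<partial>unif)"
      unfolding A_def by (rule prob_stop_at_sample_min[OF ind k dist B])
    \<comment> \<open>Pointwise comparison of the factors of the earlier observations;
      \<open>B k\<close> stays as it is.\<close>
    also have "\<dots> \<le> (\<integral>x. indicator (B k) x * f k x \<partial>unif)"
    proof (rule integral_mono_AE')
      show "integrable unif (\<lambda>x. indicator (B k) x * f k x)"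
      proof (rule unif.integrable_const_bound[where B = 1])
        show "AE x in unif. norm (indicator (B k) x * f k x) \<le> 1"
          using AE_unif_Icc by eventually_elim (use fb in \<open>auto simp: indicator_def\<close>)
      qed (use fm[of k] B[of k] in measurable)
      show "AE x in unif. indicator (B k) x *
          (measure unif {x..} ^ (n - k) * (\<Prod>j\<in>{1..<k}. measure unif (- B j \<inter> {x..}))) \<le> indicator (B k) x * f k x"
        using AE_unif_Icc
      proof eventually_elim
        case (elim x)
        have "measure unif {x..} ^ (n - k) * (\<Prod>j\<in>{1..<k}. measure unif (- B j \<inter> {x..})) \<le> f k x"
          unfolding f_def using elim measure_unif_Compl_atLeast[OF B, of x]
          by (intro mult_mono prod_mono prod_nonneg) (auto simp: measure_unif_atLeast d_def)
        then show ?case by (intro mult_left_mono) auto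
      qed
      show "AE x in unif. 0 \<le> indicator (B k) x * f k x"
        using AE_unif_Icc by eventually_elim (use fb in auto)
    qed
    \<comment> \<open>Now the integrand depends on the earlier sets only through their measures and
      is decreasing, so rearrangement applies to \<open>B k\<close>.\<close>
    also have "\<dots> \<le> (\<integral>x. indicator {..d k} x * f k x \<partial>unif)"
      unfolding d_def[of k]
    proof (rule rearrangement_unif[OF B fm])
      show "\<bar>f k x\<bar> \<le> 1" if "0 \<le> x" "x \<le> 1" for x using fb[OF that] by auto
      show "f k y \<le> f k x" if "0 \<le> x" "x \<le> y" "y \<le> 1" for x y
        unfolding f_def using d that by (intro win_density_term_antimono) auto
    qed
    finally show "prob (A k) \<le> (\<integral>x. indicator {..d k} x * f k x \<partial>unif)" .
  qed
  also have "\<dots> = threshold_value n d"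
    unfolding f_def by (simp only: threshold_value_eq_sum[OF d])
  finally show ?thesis using d that by blast
qed

text \<open>For initial intervals the factors of the earlier observations are computed exactly
  instead of estimated. The condition \<open>thr\<close> constrains \<open>\<tau>\<close> only where
  some observation meets its threshold, as the first half of \<open>threshold_form\<close>
  does.\<close>

lemma threshold_value_le_win_prob:
  fixes X :: "nat \<Rightarrow> 'a \<Rightarrow> real"
  assumes ind: "indep_vars (\<lambda>_. borel) X {1..n}"
    and dist: "\<And>i. i \<in> {1..n} \<Longrightarrow> distr M borel (X i) = unif"
    and d: "\<And>j. 0 \<le> d j \<and> d j \<le> 1"
    and tau: "\<tau> \<in> memoryless_rules M n X"
    and thr: "\<And>k \<omega>. k \<in> {1..n} \<Longrightarrow> \<omega> \<in> space M \<Longrightarrow> X k \<omega> \<le> d k \<Longrightarrow> (\<And>j. j \<in> {1..<k} \<Longrightarrow> d j < X j \<omega>) \<Longrightarrow> \<tau> \<omega> = k"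
  shows "threshold_value n d \<le> win_prob M n X \<tau>"
proof -
  define B where "B j = {..d j}" for j
  have B: "B j \<in> sets borel" for j by (auto simp: B_def)
  define f where "f k x = (1 - x) ^ (n - k) * (\<Prod>j\<in>{1..<k}. 1 - max x (d j))" for k and x :: real
  define A where "A k = {\<omega> \<in> space M. X k \<omega> \<in> B k \<and> (\<forall>j\<in>{1..<k}. X j \<omega> \<notin> B j) \<and> (\<forall>j\<in>{1..n}. X k \<omega> \<le> X j \<omega>)}" for k
  have A: "A k \<in> events" if "k \<in> {1..n}" for k
    unfolding A_def by (rule stop_at_sample_min_event[OF ind that B])
  have fm: "f k \<in> borel_measurable borel" for k
    unfolding f_def[abs_def] by measurable
  have At: "\<tau> \<omega> = k" if "\<omega> \<in> A k" "k \<in> {1..n}" for k \<omega>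
    using that by (intro thr) (auto simp: A_def B_def not_le)
  have "threshold_value n d = (\<Sum>k\<in>{1..n}. \<integral>x. indicator {..d k} x * f k x \<partial>unif)"
    unfolding f_def by (simp only: threshold_value_eq_sum[OF d])
  also have "\<dots> = (\<Sum>k\<in>{1..n}. prob (A k))"
  proof (rule sum.cong)
    fix k assume k: "k \<in> {1..n}"
    have "prob (A k) = (\<integral>x. indicator (B k) x *
        (measure unif {x..} ^ (n - k) * (\<Prod>j\<in>{1..<k}. measure unif (- B j \<inter> {x..}))) \<partial>unif)"
      unfolding A_def by (rule prob_stop_at_sample_min[OF ind k dist B])
    also have "\<dots> = (\<integral>x. indicator {..d k} x * f k x \<partial>unif)"
    proof (rule integral_cong_AE)
      show "AE x in unif. indicator (B k) x *
        (measure unif {x..} ^ (n - k) * (\<Prod>j\<in>{1..<k}. measure unif (- B j \<inter> {x..}))) = indicator {..d k} x * f k x"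
        using AE_unif_Icc
      proof eventually_elim
        case (elim x)
        have "- B j = {d j<..}" for j by (auto simp: B_def)
        then show ?case using elim d
          by (simp add: f_def B_def measure_unif_atLeast measure_unif_greater_atLeast)
      qed
      have m: "(\<lambda>x. measure unif (D \<inter> {x..})) \<in> borel_measurable borel" if "D \<in> sets borel" for D
      proof -
        have "mono (\<lambda>x. - measure unif (D \<inter> {x..}))"
          using that by (auto intro!: monoI unif.finite_measure_mono)
        from borel_measurable_mono[OF this] show ?thesis by simp
      qed
      have [measurable]: "(\<lambda>x. measure unif {x..}) \<in> borel_measurable borel"
        "(\<lambda>x. measure unif (- B j \<inter> {x..})) \<in> borel_measurable borel" for j
        using m[of UNIV] m[of "- B j"] B[of j] by (simp_all add: borel_comp)
      note [measurable] = B
      show "(\<lambda>x. indicator (B k) x *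
        (measure unif {x..} ^ (n - k) * (\<Prod>j\<in>{1..<k}. measure unif (- B j \<inter> {x..})))) \<in> borel_measurable unif"
        unfolding measurable_cong_sets[OF sets_unif refl] by measurable
    qed (use fm[of k] in measurable)
    finally show "(\<integral>x. indicator {..d k} x * f k x \<partial>unif) = prob (A k)" ..
  qed simp
  \<comment> \<open>The events are disjoint because each \<open>A k\<close> forces
    \<open>\<tau>\<close> to equal \<open>k\<close>.\<close>
  also have "\<dots> = prob (\<Union>k\<in>{1..n}. A k)"
  proof (rule finite_measure_finite_Union[symmetric])
    show "disjoint_family_on A {1..n}"
      unfolding disjoint_family_on_def using At by blast
  qed (use A in auto)
  also have "\<dots> \<le> win_prob M n X \<tau>"
    unfolding win_prob_def
  proof (rule finite_measure_mono)
    show "(\<Union>k\<in>{1..n}. A k) \<subseteq> {\<omega> \<in> space M. X (\<tau> \<omega>) \<omega> = sample_min n X \<omega>}"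
    proof safe
      fix k \<omega> assume k: "k \<in> {1..n}" and \<omega>: "\<omega> \<in> A k"
      show "\<omega> \<in> space M" using \<omega> by (auto simp: A_def)
      have "Min ((\<lambda>i. X i \<omega>) ` {1..n}) = X k \<omega>"
        using k \<omega> by (intro Min_eqI) (auto simp: A_def)
      then show "X (\<tau> \<omega>) \<omega> = sample_min n X \<omega>"
        using At[OF \<omega> k] by (simp add: sample_min_def)
    qed
    have rv[measurable]: "X i \<in> borel_measurable M" if "i \<in> {1..n}" for i
      using ind that by (auto simp: indep_vars_def)
    have t: "\<tau> \<omega> \<in> {1..n}" if "\<omega> \<in> space M" for \<omega>
      using tau that by (auto simp: memoryless_rules_def dest: measurable_space)
    \<comment> \<open>The random index is resolved by splitting over the finitely many values of
      \<open>\<tau>\<close>.\<close>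
    have "{\<omega> \<in> space M. X (\<tau> \<omega>) \<omega> = sample_min n X \<omega>} =
      (\<Union>k\<in>{1..n}. {\<omega> \<in> space M. \<tau> \<omega> = k} \<inter> {\<omega> \<in> space M. X k \<omega> = sample_min n X \<omega>})"
      using t by auto
    also have "\<dots> \<in> events"
    proof (intro sets.finite_UN sets.Int)
      fix k assume k: "k \<in> {1..n}"
      have "\<tau> -` {k} \<inter> space M \<in> events"
        using tau k by (intro measurable_sets[of \<tau> M "count_space {1..n}"]) (auto simp: memoryless_rules_def)
      then show "{\<omega> \<in> space M. \<tau> \<omega> = k} \<in> events"
        by (simp add: vimage_def Int_def conj_commute)
      have "sample_min n X \<in> borel_measurable M"
        unfolding sample_min_def[abs_def] using k by (intro borel_measurable_Min rv) auto
      then show "{\<omega> \<in> space M. X k \<omega> = sample_min n X \<omega>} \<in> events"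
        using rv[OF k] by (intro borel_measurable_eq)
    qed simp
    finally show "{\<omega> \<in> space M. X (\<tau> \<omega>) \<omega> = sample_min n X \<omega>} \<in> events" .
  qed
  finally show ?thesis .
qed

end

section \<open>Exchanging adjacent thresholds\<close>

lemma sum_split_adjacent:
  fixes g :: "nat \<Rightarrow> 'b::comm_monoid_add"
  assumes "1 \<le> k" "k < n"
  shows "(\<Sum>i\<in>{1..n}. g i) = (\<Sum>i\<in>{1..n} - {k, Suc k}. g i) + (g k + g (Suc k))"
proof -
  have e: "{1..n} = ({1..n} - {k, Suc k}) \<union> {k, Suc k}" using assms by auto
  show ?thesis by (subst e, subst sum.union_disjoint) auto
qed

text \<open>Only summands \<open>k\<close> and \<open>Suc k\<close> change. Apart from common
  factors, for \<open>x \<le> d (Suc k)\<close> the sum of \<open>1 - x\<close> and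
  \<open>1 - d k\<close> becomes that of \<open>1 - x\<close> and \<open>1 - d (Suc k)\<close>. For
  \<open>x\<close> between the two thresholds exactly one of the summands is present before and
  after, both times with factor \<open>1 - x\<close>.\<close>

lemma win_density_swap:
  assumes k: "1 \<le> k" "k < n" and less: "d (Suc k) < d k"
  shows "win_density n (d \<circ> Transposition.transpose k (Suc k)) x - win_density n d x =
    (d k - d (Suc k)) * (indicator {..d (Suc k)} x * ((1 - x) ^ (n - Suc k) * (\<Prod>j\<in>{1..<k}. 1 - max x (d j))))"
proof -
  define s where "s = Transposition.transpose k (Suc k)"
  define g where "g c i = indicator {..c i} x * ((1 - x) ^ (n - i) * (\<Prod>j\<in>{1..<i}. 1 - max x (c j)))"
    for c :: "nat \<Rightarrow> real" and i
  have sk: "s k = Suc k" "s (Suc k) = k" and so: "\<And>j. j \<noteq> k \<Longrightarrow> j \<noteq> Suc k \<Longrightarrow> s j = j"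
    by (auto simp: s_def)
  have other: "g (d \<circ> s) i = g d i" if i: "i \<in> {1..n} - {k, Suc k}" for i
  proof -
    have "(\<Prod>j\<in>{1..<i}. 1 - max x ((d \<circ> s) j)) = (\<Prod>j\<in>{1..<i}. 1 - max x (d j))"
    proof (cases "i < k")
      case True
      then show ?thesis by (intro prod.cong) (auto simp: so)
    next
      case False
      \<comment> \<open>Here \<open>i\<close> exceeds \<open>Suc k\<close>, so the product contains
        both exchanged factors and is only reordered.\<close>
      then have "s permutes {1..<i}" unfolding s_def using i k by (intro permutes_swap_id) auto
      from prod.permute[OF this, of "\<lambda>j. 1 - max x (d j)"] show ?thesis by (simp add: o_def)
    qed
    then show ?thesis using i by (simp add: g_def so)
  qed
  define P where "P = (\<Prod>j\<in>{1..<k}. 1 - max x (d j))"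
  have P: "(\<Prod>j\<in>{1..<k}. 1 - max x ((d \<circ> s) j)) = P"
    unfolding P_def by (intro prod.cong) (auto simp: so)
  have pow: "(1 - x) ^ (n - k) = (1 - x) * (1 - x) ^ (n - Suc k)"
    using k by (simp add: Suc_diff_Suc flip: power_Suc)
  have Suc: "(\<Prod>j\<in>{1..<Suc k}. 1 - max x (c j)) = (\<Prod>j\<in>{1..<k}. 1 - max x (c j)) * (1 - max x (c k))"
    for c :: "nat \<Rightarrow> real"
    using k by (simp add: prod.atLeastLessThan_Suc)
  have "win_density n (d \<circ> s) x - win_density n d x
      = (g (d \<circ> s) k + g (d \<circ> s) (Suc k)) - (g d k + g d (Suc k))"
    unfolding win_density_def g_def[symmetric] sum_split_adjacent[OF k] using other by simp
  also have "\<dots> = (d k - d (Suc k)) * (indicator {..d (Suc k)} x * ((1 - x) ^ (n - Suc k) * P))"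
    unfolding g_def Suc P P_def[symmetric] pow using less
    by (auto simp: indicator_def sk max_def algebra_simps)
  finally show ?thesis by (simp add: s_def P_def)
qed

text \<open>The gain in density is supported on \<open>{..a}\<close> with
  \<open>a = d (Suc k)\<close> and is at least its value at \<open>a\<close>. Strictness needs
  \<open>a > 0\<close> for positive measure and earlier thresholds below \<open>1\<close> for a
  positive value at \<open>a\<close>.\<close>

lemma threshold_value_swap:
  assumes k: "1 \<le> k" "k < n" and less: "0 < d (Suc k)" "d (Suc k) < d k"
    and d: "\<And>j. 0 \<le> d j \<and> d j \<le> 1" and d1: "\<And>j. j \<in> {1..<k} \<Longrightarrow> d j < 1"
  shows "threshold_value n d < threshold_value n (d \<circ> Transposition.transpose k (Suc k))"
proof -
  define a where "a = d (Suc k)"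
  define f where "f x = (1 - x) ^ (n - Suc k) * (\<Prod>j\<in>{1..<k}. 1 - max x (d j))" for x :: real
  have a: "0 < a" "a < 1" using less d[of k] by (auto simp: a_def)
  have "0 < f a" unfolding f_def using a d1 by (intro mult_pos_pos prod_pos) auto
  have dt: "0 \<le> (d \<circ> Transposition.transpose k (Suc k)) j \<and> (d \<circ> Transposition.transpose k (Suc k)) j \<le> 1" for j
    using d by simp
  have i: "integrable unif (\<lambda>x. (d k - a) * (indicator {..a} x * f a))"
    by (intro integrable_mult_right integrable_mult_left unif.integrable_const_bound[where B = 1])
      (auto simp: indicator_def)
  have "0 < (d k - a) * (a * f a)" using \<open>0 < f a\<close> a less by (simp add: a_def)
  also have "\<dots> = (\<integral>x. (d k - a) * (indicator {..a} x * f a) \<partial>unif)"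
    using a by (simp add: measure_unif_atMost)
  also have "\<dots> \<le> (\<integral>x. win_density n (d \<circ> Transposition.transpose k (Suc k)) x - win_density n d x \<partial>unif)"
  proof (rule integral_mono_AE[OF i])
    show "AE x in unif. (d k - a) * (indicator {..a} x * f a)
        \<le> win_density n (d \<circ> Transposition.transpose k (Suc k)) x - win_density n d x"
      using AE_unif_Icc
    proof eventually_elim
      case (elim x)
      have "f a \<le> f x" if "x \<le> a"
        unfolding f_def using d a that by (intro win_density_term_antimono) auto
      then show ?case
        unfolding win_density_swap[of k n d x, OF k less(2)] f_def[symmetric] a_def[symmetric]
        using less by (cases "x \<le> a") (auto simp: a_def intro: mult_left_mono)
    qed
  qed (use integrable_win_density[of "d" n, OF d] integrable_win_density[of "d \<circ> Transposition.transpose k (Suc k)" n, OF dt] in auto)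
  also have "\<dots> = threshold_value n (d \<circ> Transposition.transpose k (Suc k)) - threshold_value n d"
    unfolding threshold_value_def
    using integrable_win_density[of "d" n, OF d] integrable_win_density[of "d \<circ> Transposition.transpose k (Suc k)" n, OF dt] by simp
  finally show ?thesis by simp
qed

section \<open>Positivity of optimal thresholds\<close>

text \<open>On an interval of length \<open>e\<close>, summand \<open>k\<close> appears with size at
  least \<open>q\<close>, while every other summand loses at most \<open>e\<close>. The gain is of
  order \<open>e\<close>, the total loss of order \<open>e * e\<close>.\<close>

lemma threshold_value_raise_zero:
  assumes k: "1 \<le> k" "k \<le> n" and zero: "d k = 0"
    and d: "\<And>j. 0 \<le> d j \<and> d j \<le> 1" and d1: "\<And>j. j \<in> {1..<k} \<Longrightarrow> d j < 1"
  shows "\<exists>e. 0 < e \<and> e < 1 \<and> threshold_value n d < threshold_value n (d(k := e))"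
proof -
  define f where "f x = (1 - x) ^ (n - k) * (\<Prod>j\<in>{1..<k}. 1 - max x (d j))" for x :: real
  define q where "q = f (1/2)"
  have q0: "0 < q" unfolding q_def f_def using d1 by (intro mult_pos_pos prod_pos) auto
  have q1: "q \<le> 1" unfolding q_def f_def using d by (intro win_density_term_bounds) auto
  \<comment> \<open>This keeps the combined loss below \<open>n * e = q / 2\<close>, half of the
    gain, and makes \<open>e \<le> 1 / 2\<close>, so that \<open>f\<close> is at least
    \<open>q = f (1/2)\<close> on the interval.\<close>
  define e where "e = q / (2 * n)"
  have "q / (2 * n) \<le> 1 / 2" using q1 k by (simp add: field_simps)
  then have e: "0 < e" "e \<le> 1 / 2" using q0 k by (auto simp: e_def)
  have ne: "n * e = q / 2" using k by (simp add: e_def)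
  define c where "c = d(k := e)"
  have c: "0 \<le> c j \<and> c j \<le> 1" for j using d e by (auto simp: c_def)
  have i: "integrable unif (\<lambda>x. indicator {..e} x * (q - n * e))"
    by (intro integrable_mult_left unif.integrable_const_bound[where B = 1]) (auto simp: indicator_def)
  have "0 < e * (q - n * e)" using e q0 ne by simp
  also have "\<dots> = (\<integral>x. indicator {..e} x * (q - n * e) \<partial>unif)"
    using e by (simp add: measure_unif_atMost)
  also have "\<dots> \<le> (\<integral>x. win_density n c x - win_density n d x \<partial>unif)"
  proof (rule integral_mono_AE[OF i])
    show "AE x in unif. indicator {..e} x * (q - n * e) \<le> win_density n c x - win_density n d x"
      \<comment> \<open>At \<open>x = 0\<close> summand \<open>k\<close> is already present with
        threshold \<open>0\<close>, so this point is discarded.\<close>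
      using AE_unif_Icc AE_unif_neq[of 0]
    proof eventually_elim
      case (elim x)
      then have x: "0 < x" "x \<le> 1" by auto
      define g where "g b i = indicator {..b i} x * ((1 - x) ^ (n - i) * (\<Prod>j\<in>{1..<i}. 1 - max x (b j)))"
        for b :: "nat \<Rightarrow> real" and i
      have gk: "indicator {..e} x * q \<le> g c k - g d k"
      proof -
        have "(\<Prod>j\<in>{1..<k}. 1 - max x (c j)) = (\<Prod>j\<in>{1..<k}. 1 - max x (d j))"
          by (intro prod.cong) (auto simp: c_def)
        then have "g c k - g d k = indicator {..e} x * f x"
          using zero x by (simp add: g_def c_def f_def)
        moreover have "q \<le> f x" if "x \<le> e"
          unfolding q_def f_def using d e that by (intro win_density_term_antimono) auto
        ultimately show ?thesis by (auto simp: indicator_def)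
      qed
      \<comment> \<open>Only summands after \<open>k\<close> at points \<open>x \<le> e\<close>
        change: their factor for \<open>k\<close> drops from \<open>1 - x\<close> to
        \<open>1 - e\<close>.\<close>
      have gi: "- (e * indicator {..e} x) \<le> g c i - g d i" if i: "i \<in> {1..n} - {k}" for i
      proof (cases "i < k \<or> e < x")
        case True
        then have "(\<Prod>j\<in>{1..<i}. 1 - max x (c j)) = (\<Prod>j\<in>{1..<i}. 1 - max x (d j))"
          using x zero by (intro prod.cong) (auto simp: c_def)
        then have "g c i = g d i" using i by (simp add: g_def c_def)
        then show ?thesis using e by (simp add: indicator_def)
      next
        case False
        then have ki: "k \<in> {1..<i}" using i k by auto
        define Q where "Q = (1 - x) ^ (n - i) * (\<Prod>j\<in>{1..<i} - {k}. 1 - max x (d j))"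
        have Q: "0 \<le> Q" "Q \<le> 1"
          unfolding Q_def using x d by (intro win_density_term_bounds; auto)+
        have p1: "(\<Prod>j\<in>{1..<i}. 1 - max x (c j)) = (1 - max x e) * (\<Prod>j\<in>{1..<i} - {k}. 1 - max x (d j))"
          by (subst prod.remove[OF _ ki]) (auto simp: c_def intro!: prod.cong)
        have p2: "(\<Prod>j\<in>{1..<i}. 1 - max x (d j)) = (1 - x) * (\<Prod>j\<in>{1..<i} - {k}. 1 - max x (d j))"
          using x zero by (subst prod.remove[OF _ ki]) auto
        have "c i = d i" using i by (simp add: c_def)
        then have "g c i - g d i = indicator {..d i} x * (Q * (x - max x e))"
          unfolding g_def p1 p2 Q_def by (simp add: algebra_simps)
        also have "\<dots> = - (indicator {..d i} x * (Q * (e - x)))"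
          using False by (simp add: algebra_simps)
        finally have "g c i - g d i = - (indicator {..d i} x * (Q * (e - x)))" .
        moreover have "indicator {..d i} x * (Q * (e - x)) \<le> 1 * (1 * e)"
          using Q False x by (intro mult_mono) (auto simp: indicator_def)
        ultimately show ?thesis using False by (simp add: indicator_def)
      qed
      have "indicator {..e} x * (q - n * e) \<le> indicator {..e} x * q - (real n - 1) * (e * indicator {..e} x)"
        using e by (auto simp: indicator_def algebra_simps)
      also have "\<dots> = indicator {..e} x * q + (\<Sum>i\<in>{1..n} - {k}. - (e * indicator {..e} x))"
        using k by (simp add: of_nat_diff)
      also have "\<dots> \<le> (g c k - g d k) + (\<Sum>i\<in>{1..n} - {k}. g c i - g d i)"
        using gk gi by (intro add_mono sum_mono) auto
      also have "\<dots> = (\<Sum>i\<in>{1..n}. g c i - g d i)"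
        using k by (subst (2) sum.remove[of _ k]) auto
      also have "\<dots> = win_density n c x - win_density n d x"
        by (simp add: win_density_def g_def sum_subtractf)
      finally show ?case .
    qed
  qed (use integrable_win_density[of "d" n, OF d] integrable_win_density[of "c" n, OF c] in auto)
  also have "\<dots> = threshold_value n c - threshold_value n d"
    unfolding threshold_value_def
    using integrable_win_density[of "d" n, OF d] integrable_win_density[of "c" n, OF c] by simp
  finally show ?thesis using e by (intro exI[of _ e]) (simp add: c_def)
qed

section \<open>Shape of the optimal thresholds\<close>

text \<open>The order of the claims matters: thresholds below \<open>1\<close> come first, since
  both perturbations require this of the earlier ones; then positivity, which the exchange requires
  of the smaller threshold; then monotonicity.\<close>

lemma optimal_thresholds:
  assumes n: "1 \<le> n"
  obtains d where "\<And>j. 0 \<le> d j \<and> d j \<le> 1" "d n = 1"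
    "\<And>j. j \<in> {1..<n} \<Longrightarrow> 0 < d j \<and> d j < 1"
    "\<And>k. k \<in> {1..<n} \<Longrightarrow> d k \<le> d (Suc k)"
    "\<And>c. (\<And>j. 0 \<le> c j \<and> c j \<le> 1) \<Longrightarrow> threshold_value n c \<le> threshold_value n d"
proof -
  obtain d0 where d0: "\<And>j. 0 \<le> d0 j \<and> d0 j \<le> 1"
    and max0: "\<And>c. (\<And>j. 0 \<le> c j \<and> c j \<le> 1) \<Longrightarrow> threshold_value n c \<le> threshold_value n d0"
    using threshold_value_attains_max by blast
  \<comment> \<open>The last threshold occurs in no product, only in its own indicator, so raising
    it to \<open>1\<close> cannot lower the value.\<close>
  define d where "d = d0(n := 1)"
  have d: "0 \<le> d j \<and> d j \<le> 1" for j using d0 by (simp add: d_def)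
  have "threshold_value n d0 \<le> threshold_value n d"
    unfolding threshold_value_def
  proof (rule integral_mono_AE[OF integrable_win_density[of "d0" n, OF d0] integrable_win_density[of "d" n, OF d]])
    show "AE x in unif. win_density n d0 x \<le> win_density n d x"
      using AE_unif_Icc
    proof eventually_elim
      case (elim x)
      show ?case unfolding win_density_def
      proof (rule sum_mono)
        fix i assume i: "i \<in> {1..n}"
        have "(\<Prod>j\<in>{1..<i}. 1 - max x (d j)) = (\<Prod>j\<in>{1..<i}. 1 - max x (d0 j))"
          using i by (intro prod.cong) (auto simp: d_def)
        moreover have "0 \<le> (1 - x) ^ (n - i) * (\<Prod>j\<in>{1..<i}. 1 - max x (d0 j))"
          using d0 elim by (intro win_density_term_bounds) auto
        moreover have "indicator {..d0 i} x \<le> (indicator {..d i} x :: real)"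
          using d0[of n] by (auto simp: indicator_def d_def)
        ultimately show "indicator {..d0 i} x * ((1 - x) ^ (n - i) * (\<Prod>j\<in>{1..<i}. 1 - max x (d0 j)))
            \<le> indicator {..d i} x * ((1 - x) ^ (n - i) * (\<Prod>j\<in>{1..<i}. 1 - max x (d j)))"
          by (simp add: mult_right_mono)
      qed
    qed
  qed
  note le = this
  have max: "threshold_value n c \<le> threshold_value n d" if "\<And>j. 0 \<le> c j \<and> c j \<le> 1" for c
    by (rule order_trans[OF max0[of c, OF that] le])
  \<comment> \<open>Stated for every \<open>c\<close> of optimal value, because it is also applied
    to a modification of \<open>d\<close>.\<close>
  have no_swap: False
    if "1 \<le> k" "k < n" "0 < c (Suc k)" "c (Suc k) < c k" "\<And>j. 0 \<le> c j \<and> c j \<le> 1"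
      "\<And>j. j \<in> {1..<k} \<Longrightarrow> c j < 1" "threshold_value n c = threshold_value n d" for k c
    using threshold_value_swap[of k n c, OF that(1-6)] that(5,7) max[of "c \<circ> Transposition.transpose k (Suc k)"] by simp
  have lt1: "d j < 1" if "j \<in> {1..<n}" for j
    using that
  proof (induction j rule: less_induct)
    case (less k)
    have prev: "d j < 1" if "j \<in> {1..<k}" for j using less that by auto
    show ?case
    proof (rule ccontr)
      assume "\<not> d k < 1"
      then have dk: "d k = 1" using d[of k] by auto
      \<comment> \<open>If \<open>d k = 1\<close>, every summand after \<open>k\<close> contains a
        vanishing factor, so the value is unchanged. The new sequence drops from \<open>1\<close> to
        \<open>1 / 2\<close> at \<open>k\<close>, also when \<open>Suc k = n\<close>, and the
        exchange improves it strictly.\<close>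
      define c where "c = d(Suc k := 1 / 2)"
      have "threshold_value n c = threshold_value n d"
        unfolding threshold_value_def
      proof (rule integral_cong_AE)
        show "AE x in unif. win_density n c x = win_density n d x"
          using AE_unif_Icc
        proof eventually_elim
          case (elim x)
          show ?case unfolding win_density_def
          proof (rule sum.cong)
            fix i assume i: "i \<in> {1..n}"
            show "indicator {..c i} x * ((1 - x) ^ (n - i) * (\<Prod>j\<in>{1..<i}. 1 - max x (c j)))
              = indicator {..d i} x * ((1 - x) ^ (n - i) * (\<Prod>j\<in>{1..<i}. 1 - max x (d j)))"
            proof (cases "i \<le> k")
              case True
              then have "(\<Prod>j\<in>{1..<i}. 1 - max x (c j)) = (\<Prod>j\<in>{1..<i}. 1 - max x (d j))"
                by (intro prod.cong) (auto simp: c_def)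
              then show ?thesis using True by (simp add: c_def)
            next
              case False
              then have "k \<in> {1..<i}" using less by auto
              moreover have "1 - max x (c k) = 0" "1 - max x (d k) = 0"
                using elim dk by (auto simp: c_def)
              ultimately have "(\<Prod>j\<in>{1..<i}. 1 - max x (c j)) = 0" "(\<Prod>j\<in>{1..<i}. 1 - max x (d j)) = 0"
                by (auto intro!: prod_zero)
              then show ?thesis by (simp only: mult_zero_right)
            qed
          qed simp
        qed
      qed (auto simp: measurable_cong_sets[OF sets_unif refl])
      then show False
        using less(2) d prev dk by (intro no_swap[of k c]) (auto simp: c_def)
    qed
  qed
  have gt0: "0 < d j" if "j \<in> {1..<n}" for j
  proof (rule ccontr)
    assume "\<not> 0 < d j"
    then have "d j = 0" using d[of j] by auto
    moreover have "1 \<le> j" "j \<le> n" "\<And>i. i \<in> {1..<j} \<Longrightarrow> d i < 1"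
      using that lt1 by auto
    ultimately obtain e where e: "0 < e" "e < 1" "threshold_value n d < threshold_value n (d(j := e))"
      using threshold_value_raise_zero[of j n d, OF _ _ _ d] by blast
    have "threshold_value n (d(j := e)) \<le> threshold_value n d"
      using d e by (intro max) auto
    then show False using e by simp
  qed
  have "d k \<le> d (Suc k)" if k: "k \<in> {1..<n}" for k
  proof (cases "Suc k = n")
    case True
    then show ?thesis using d[of k] by (simp add: d_def)
  next
    case False
    then show ?thesis using no_swap[of k d, OF _ _ _ _ d] k lt1 gt0[of "Suc k"] by (cases "d (Suc k) < d k") auto
  qed
  moreover have "d n = 1" by (simp add: d_def)
  ultimately show ?thesis using d max lt1 gt0 by (intro that[of d]) auto
qed

section \<open>Construction of a memoryless threshold rule\<close>

lemma sigma_sets_binary_Int: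
  assumes "G \<subseteq> Pow \<Omega>" "A \<in> sigma_sets \<Omega> G" "B \<in> sigma_sets \<Omega> G"
  shows "A \<inter> B \<in> sigma_sets \<Omega> G"
proof -
  interpret sigma_algebra \<Omega> "sigma_sets \<Omega> G"
    by (rule sigma_algebra_sigma_sets[OF assms(1)])
  show ?thesis using assms(2,3) by (rule Int)
qed

lemma threshold_rule_exists:
  fixes X :: "nat \<Rightarrow> 'a \<Rightarrow> real"
  assumes n: "1 \<le> n" and rv: "\<And>k. k \<in> {1..n} \<Longrightarrow> X k \<in> borel_measurable M"
  obtains \<tau> where "\<tau> \<in> memoryless_rules M n X"
    and "\<And>\<omega>. {k \<in> {1..n}. X k \<omega> \<le> d k} \<noteq> {} \<Longrightarrow> \<tau> \<omega> = Min {k \<in> {1..n}. X k \<omega> \<le> d k}"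
proof -
  \<comment> \<open>Adding \<open>n\<close> makes the rule stop at the last time if no observation
    meets its threshold; otherwise the minimum is unaffected.\<close>
  define S where "S \<omega> = insert n {k \<in> {1..n}. X k \<omega> \<le> d k}" for \<omega>
  define \<tau> where "\<tau> \<omega> = Min (S \<omega>)" for \<omega>
  have fin: "finite (S \<omega>)" "S \<omega> \<noteq> {}" for \<omega> by (auto simp: S_def)
  have S: "S \<omega> \<subseteq> {1..n}" for \<omega> using n by (auto simp: S_def)
  have t: "\<tau> \<omega> \<in> S \<omega>" for \<omega> unfolding \<tau>_def by (rule Min_in[OF fin])
  then have tn: "\<tau> \<omega> \<in> {1..n}" for \<omega> using S by blast
  \<comment> \<open>The memoryless property in pointwise form; both measurability of
    \<open>\<tau>\<close> and membership in the generated sigma-algebra are read off from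
    it.\<close>
  have tk: "\<tau> \<omega> = k \<longleftrightarrow> k - 1 < \<tau> \<omega> \<and> (k = n \<or> X k \<omega> \<le> d k)" if k: "k \<in> {1..n}" for k \<omega>
  proof
    assume "\<tau> \<omega> = k"
    then show "k - 1 < \<tau> \<omega> \<and> (k = n \<or> X k \<omega> \<le> d k)"
      using t[of \<omega>] k by (auto simp: S_def)
  next
    assume *: "k - 1 < \<tau> \<omega> \<and> (k = n \<or> X k \<omega> \<le> d k)"
    then have "\<tau> \<omega> \<le> k" unfolding \<tau>_def using k by (intro Min_le fin) (auto simp: S_def)
    then show "\<tau> \<omega> = k" using * by auto
  qed
  have C: "{\<omega> \<in> space M. X k \<omega> \<le> d k} \<in> sets M" if "k \<in> {1..n}" for k
    using rv[OF that] by measurable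
  have gt: "{\<omega> \<in> space M. k < \<tau> \<omega>} \<in> sets M" if "k \<le> n" for k
    using that
  proof (induction k)
    case 0
    then show ?case using tn by (simp add: Suc_le_eq)
  next
    case (Suc k)
    have split: "\<tau> \<omega> > Suc k \<longleftrightarrow> \<tau> \<omega> > k \<and> \<not> (Suc k = n \<or> X (Suc k) \<omega> \<le> d (Suc k))" for \<omega>
      using tk[of "Suc k" \<omega>] Suc.prems by auto
    have "{\<omega> \<in> space M. k < \<tau> \<omega>} \<in> sets M" using Suc by simp
    moreover have "{\<omega> \<in> space M. Suc k = n \<or> X (Suc k) \<omega> \<le> d (Suc k)} \<in> sets M"
      using C[of "Suc k"] Suc.prems by (cases "Suc k = n") auto
    ultimately show ?case unfolding split by (intro sets.sets_Collect_conj sets.sets_Collect_neg)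
  qed
  have eq: "{\<omega> \<in> space M. \<tau> \<omega> = k} \<in> sets M" if k: "k \<in> {1..n}" for k
  proof -
    have 1: "{\<omega> \<in> space M. k - 1 < \<tau> \<omega>} \<in> sets M" using k by (intro gt) auto
    have 2: "{\<omega> \<in> space M. k = n \<or> X k \<omega> \<le> d k} \<in> sets M"
      using C[OF k] by (cases "k = n") auto
    have 3: "{\<omega> \<in> space M. \<tau> \<omega> = k}
        = {\<omega> \<in> space M. k - 1 < \<tau> \<omega> \<and> (k = n \<or> X k \<omega> \<le> d k)}"
      using tk[OF k] by blast
    show ?thesis unfolding 3 using 1 2 by (intro sets.sets_Collect_conj)
  qed
  have "\<tau> \<in> memoryless_rules M n X"
    unfolding memoryless_rules_def
  proof (intro CollectI conjI ballI)
    show "\<tau> \<in> measurable M (count_space {1..n})"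
      using tn eq by (subst measurable_count_space_eq2) (auto simp: vimage_def Int_def conj_commute)
    fix k assume k: "k \<in> {1..n}"
    let ?E = "{\<omega> \<in> space M. \<tau> \<omega> > k - 1}"
    let ?G = "insert ?E {X k -` A \<inter> space M | A. A \<in> sets borel}"
    have G: "?G \<subseteq> Pow (space M)" by blast
    have E: "?E \<in> sigma_sets (space M) ?G" by (rule sigma_sets.Basic) simp
    show "{\<omega> \<in> space M. \<tau> \<omega> = k} \<in> sigma_sets (space M) ?G"
    proof (cases "k = n")
      case True
      then have "{\<omega> \<in> space M. \<tau> \<omega> = k} = ?E" using tk[OF k] by auto
      then show ?thesis using E by simp
    next
      case False
      have "X k -` {..d k} \<inter> space M \<in> sigma_sets (space M) ?G"
        by (intro sigma_sets.Basic insertI2 CollectI exI[of _ "{..d k}"] conjI refl atMost_borel)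
      from sigma_sets_binary_Int[OF G E this]
      have "?E \<inter> (X k -` {..d k} \<inter> space M) \<in> sigma_sets (space M) ?G" .
      moreover have "{\<omega> \<in> space M. \<tau> \<omega> = k} = ?E \<inter> (X k -` {..d k} \<inter> space M)"
        using tk[OF k] False by auto
      ultimately show ?thesis by (simp only:)
    qed
  qed
  moreover have "\<tau> \<omega> = Min {k \<in> {1..n}. X k \<omega> \<le> d k}" if ne: "{k \<in> {1..n}. X k \<omega> \<le> d k} \<noteq> {}" for \<omega>
  proof -
    have fin': "finite {k \<in> {1..n}. X k \<omega> \<le> d k}" by simp
    have "Min {k \<in> {1..n}. X k \<omega> \<le> d k} \<le> n"
      using Min_in[OF fin' ne] by auto
    then show ?thesis
      unfolding \<tau>_def S_def by (subst Min_insert[OF fin' ne]) auto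
  qed
  ultimately show ?thesis using that by blast
qed

section \<open>Optimality among all memoryless rules\<close>

theorem theorem1:
  fixes M :: "'a measure" and n :: nat and X :: "nat \<Rightarrow> 'a \<Rightarrow> real"
  assumes "prob_space M"
    and "n \<ge> 1"
    and "prob_space.indep_vars M (\<lambda>_. borel) X {1..n}"
    and "\<And>k. k \<in> {1..n} \<Longrightarrow> distr M borel (X k) = uniform_measure lborel {0..1}"
  shows "\<exists>(d :: nat \<Rightarrow> real) \<tau>.
    0 < d 1 \<and> mono_on {1..n} d \<and> (n \<ge> 2 \<longrightarrow> d (n - 1) < d n) \<and> d n = 1 \<and>
    \<tau> \<in> memoryless_rules M n X \<and>
    threshold_form M n X d \<tau> \<and>
    win_prob M n X \<tau> = memoryless_value M n X"
proof -
  interpret prob_space M by fact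
  note n = assms(2) and ind = assms(3)
  have dist: "distr M borel (X k) = unif" if "k \<in> {1..n}" for k
    using assms(4)[OF that] by (simp add: unif_def)
  have rv: "X k \<in> borel_measurable M" if "k \<in> {1..n}" for k
    using ind that by (auto simp: indep_vars_def)
  obtain d where d: "\<And>j. 0 \<le> d j \<and> d j \<le> 1" "d n = 1"
    and d01: "\<And>j. j \<in> {1..<n} \<Longrightarrow> 0 < d j \<and> d j < 1"
    and step: "\<And>k. k \<in> {1..<n} \<Longrightarrow> d k \<le> d (Suc k)"
    and max: "\<And>c. (\<And>j. 0 \<le> c j \<and> c j \<le> 1) \<Longrightarrow> threshold_value n c \<le> threshold_value n d"
    using optimal_thresholds[OF n] by blast
  obtain \<tau> where \<tau>: "\<tau> \<in> memoryless_rules M n X"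
    and Min: "\<And>\<omega>. {k \<in> {1..n}. X k \<omega> \<le> d k} \<noteq> {} \<Longrightarrow> \<tau> \<omega> = Min {k \<in> {1..n}. X k \<omega> \<le> d k}"
    using threshold_rule_exists[where d = d and X = X and M = M, OF n rv] by blast
  have pos: "0 < d 1" using d01[of 1] d(2) n by (cases "n = 1") auto
  have mono: "mono_on {1..n} d"
  proof (rule mono_onI)
    fix r s assume rs: "r \<in> {1..n}" "s \<in> {1..n}" "r \<le> s"
    from \<open>r \<le> s\<close> show "d r \<le> d s"
      using rs(1,2)
    proof (induction rule: dec_induct)
      case (step m)
      then show ?case using \<open>\<And>k. k \<in> {1..<n} \<Longrightarrow> d k \<le> d (Suc k)\<close>[of m] by force
    qed simp
  qed
  \<comment> \<open>Since \<open>d n = 1\<close>, the last observation almost surely meets its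
    threshold.\<close>
  have "AE x in distr M borel (X n). x \<le> 1"
    using AE_unif_Icc n by (subst dist) auto
  then have "AE \<omega> in M. X n \<omega> \<le> 1"
    using rv[of n] n by (subst (asm) AE_distr_iff) auto
  then have "AE \<omega> in M. {k \<in> {1..n}. X k \<omega> \<le> d k} \<noteq> {}"
    by eventually_elim (use n d(2) in \<open>auto intro!: exI[of _ n]\<close>)
  then have form: "threshold_form M n X d \<tau>"
    unfolding threshold_form_def using Min by blast
  have lower: "threshold_value n d \<le> win_prob M n X \<tau>"
  proof (rule threshold_value_le_win_prob[OF ind dist d(1) \<tau>])
    fix k \<omega> assume k: "k \<in> {1..n}" "X k \<omega> \<le> d k" and before: "\<And>j. j \<in> {1..<k} \<Longrightarrow> d j < X j \<omega>"
    have "Min {i \<in> {1..n}. X i \<omega> \<le> d i} = k"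
    proof (rule Min_eqI)
      fix i assume "i \<in> {i \<in> {1..n}. X i \<omega> \<le> d i}"
      then show "k \<le> i" using before[of i] by force
    qed (use k in auto)
    then show "\<tau> \<omega> = k" using Min[of \<omega>] k by blast
  qed
  have upper: "win_prob M n X \<sigma> \<le> threshold_value n d" if \<sigma>: "\<sigma> \<in> memoryless_rules M n X" for \<sigma>
  proof -
    obtain c where c: "\<And>j. 0 \<le> c j \<and> c j \<le> 1" "win_prob M n X \<sigma> \<le> threshold_value n c"
      using win_prob_le_threshold_value[OF ind dist \<sigma>] by blast
    show ?thesis by (rule order_trans[OF c(2) max[of c, OF c(1)]])
  qed
  \<comment> \<open>The number \<open>threshold_value n d\<close> lies above every memoryless
    winning probability and not above that of \<open>\<tau>\<close>, so the supremum is a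
    maximum.\<close>
  have "memoryless_value M n X = win_prob M n X \<tau>"
    unfolding memoryless_value_def
  proof (rule cSup_eq_maximum)
    show "win_prob M n X \<tau> \<in> win_prob M n X ` memoryless_rules M n X" using \<tau> by blast
    show "x \<le> win_prob M n X \<tau>" if "x \<in> win_prob M n X ` memoryless_rules M n X" for x
      using that upper lower by fastforce
  qed
  moreover have "n \<ge> 2 \<longrightarrow> d (n - 1) < d n" using d01[of "n - 1"] d(2) by auto
  ultimately show ?thesis using pos mono d(2) \<tau> form by (intro exI[of _ d] exI[of _ \<tau>]) simp
qed

end
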